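(* Let $N$ and $X$ be finite sets, $n=|N|$, $x=|X|$. Then $$|\mathcal B(N,X)|=2^{nx},\qquad |\mathcal I_r(N,X)|=(1+n)^x,\qquad |\mathcal S_r(N,X)|=(2^n-1)^x,$$ $$|\mathcal I_{lr}(N,X)|=\sum_{k=0}^{\min\{n,x\}}\binom nk\binom xk k!=\sum_{k=0}^{\min\{n,x\}}\binom nk x^{\underline{k}},$$ $$|\mathcal S_{lr}(N,X)|=\sum_{k=0}^{n}(-1)^k\binom nk(2^{n-k}-1)^x,$$ and also $|\mathcal I_l(N,X)|=(1+x)^n$ and $|\mathcal S_l(N,X)|=(2^x-1)^n$.
   Context: $\mathcal B(N,X)$ is the set of all binary relations $R\subseteq N\times X$. A relation $R$ is right injective (resp. right surjective) if for every $a\in X$ there is at most one (resp. at least one) $i\in N$ with $(i,a)\in R$; it is left injective (resp. left surjective) if for every $i\in N$ there is at most one (resp. at least one) $a\in X$ with $(i,a)\in R$. $\mathcal I_r,\mathcal I_l$ denote the sets of right injective, left injective relations; $\mathcal S_r,\mathcal S_l$ the sets of right surjective, left surjective relations; $\mathcal I_{lr}$ (resp. $\mathcal S_{lr}$) the set of relations that are both left and right injective (resp. both left and right surjective). $x^{\underline{k}}=x(x-1)\cdots(x-k+1)$, with $x^{\underline 0}=1$. Convention: $0^0=1$. *)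

theory Defs
  imports Complex_Main
begin

definition rels :: "'a set \<Rightarrow> 'b set \<Rightarrow> ('a \<times> 'b) set set" where
  "rels N X = {R. R \<subseteq> N \<times> X}"

definition right_injective :: "'a set \<Rightarrow> 'b set \<Rightarrow> ('a \<times> 'b) set \<Rightarrow> bool" where
  "right_injective N X R \<longleftrightarrow> (\<forall>a\<in>X. \<forall>i\<in>N. \<forall>j\<in>N. (i, a) \<in> R \<and> (j, a) \<in> R \<longrightarrow> i = j)"

definition right_surjective :: "'a set \<Rightarrow> 'b set \<Rightarrow> ('a \<times> 'b) set \<Rightarrow> bool" where
  "right_surjective N X R \<longleftrightarrow> (\<forall>a\<in>X. \<exists>i\<in>N. (i, a) \<in> R)"

definition left_injective :: "'a set \<Rightarrow> 'b set \<Rightarrow> ('a \<times> 'b) set \<Rightarrow> bool" where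
  "left_injective N X R \<longleftrightarrow> (\<forall>i\<in>N. \<forall>a\<in>X. \<forall>b\<in>X. (i, a) \<in> R \<and> (i, b) \<in> R \<longrightarrow> a = b)"

definition left_surjective :: "'a set \<Rightarrow> 'b set \<Rightarrow> ('a \<times> 'b) set \<Rightarrow> bool" where
  "left_surjective N X R \<longleftrightarrow> (\<forall>i\<in>N. \<exists>a\<in>X. (i, a) \<in> R)"

definition Inj_r :: "'a set \<Rightarrow> 'b set \<Rightarrow> ('a \<times> 'b) set set" where
  "Inj_r N X = {R \<in> rels N X. right_injective N X R}"

definition Inj_l :: "'a set \<Rightarrow> 'b set \<Rightarrow> ('a \<times> 'b) set set" where
  "Inj_l N X = {R \<in> rels N X. left_injective N X R}"

definition Surj_r :: "'a set \<Rightarrow> 'b set \<Rightarrow> ('a \<times> 'b) set set" where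
  "Surj_r N X = {R \<in> rels N X. right_surjective N X R}"

definition Surj_l :: "'a set \<Rightarrow> 'b set \<Rightarrow> ('a \<times> 'b) set set" where
  "Surj_l N X = {R \<in> rels N X. left_surjective N X R}"

definition Inj_lr :: "'a set \<Rightarrow> 'b set \<Rightarrow> ('a \<times> 'b) set set" where
  "Inj_lr N X = {R \<in> rels N X. left_injective N X R \<and> right_injective N X R}"

definition Surj_lr :: "'a set \<Rightarrow> 'b set \<Rightarrow> ('a \<times> 'b) set set" where
  "Surj_lr N X = {R \<in> rels N X. left_surjective N X R \<and> right_surjective N X R}"

definition falling_fact :: "'a::comm_ring_1 \<Rightarrow> nat \<Rightarrow> 'a" where
  "falling_fact x k = (\<Prod>i<k. x - of_nat i)"

end

theory Submission
  imports Defs "HOL-Library.FuncSet"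
begin

text \<open>
  A relation between \<open>N\<close> and \<open>X\<close> is the same as a family of subsets of \<open>N\<close>, one for each \<open>a \<in> X\<close>:
  the fibres \<open>{i. (i, a) \<in> R}\<close>. Any condition that restricts each fibre separately therefore leaves
  a power with exponent \<open>x\<close>, whose base counts the admissible subsets of \<open>N\<close>
  (lemma \<open>card_rels_fibres\<close>): all \<open>2 ^ n\<close> of them for \<open>\<B>\<close>, the \<open>1 + n\<close> subsets with at most one
  element for right injectivity, the \<open>2 ^ n - 1\<close> nonempty ones for right surjectivity. Taking
  converses exchanges left and right.

  The two-sided conditions couple different fibres, and are handled by sorting relations by their
  domain \<open>A \<subseteq> N\<close> (lemma \<open>card_rels_by_Domain\<close>). A relation with domain \<open>A\<close> that is injective on both
  sides is the graph of an injective function from \<open>A\<close> to \<open>X\<close>; there are \<open>x (x - 1) \<cdots> (x - |A| + 1)\<close>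
  of these. A right surjective relation with domain \<open>T\<close> is a relation between \<open>T\<close> and \<open>X\<close> that is
  surjective on both sides, so that
  \<open>(2 ^ |S| - 1) ^ x = (\<Sum>T \<subseteq> S. |\<S>\<^sub>l\<^sub>r(T, X)|)\<close> for every finite \<open>S\<close>, and Moebius inversion on the subset
  lattice recovers the summands.
\<close>

section \<open>One-sided conditions\<close>

text \<open>The correspondence sends \<open>R\<close> to the function \<open>a \<mapsto> {i. (i, a) \<in> R}\<close> on \<open>X\<close>.\<close>

lemma card_rels_fibres:
  assumes "finite X" "F \<subseteq> Pow N"
  shows "card {R \<in> rels N X. \<forall>a\<in>X. {i. (i, a) \<in> R} \<in> F} = card F ^ card X"
proof -
  have "bij_betw (\<lambda>R. \<lambda>a\<in>X. {i. (i, a) \<in> R})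
      {R \<in> rels N X. \<forall>a\<in>X. {i. (i, a) \<in> R} \<in> F} (X \<rightarrow>\<^sub>E F)"
  proof (rule bij_betw_byWitness[where f' = "\<lambda>g. {(i, a). a \<in> X \<and> i \<in> g a}"])
    show "\<forall>R\<in>{R \<in> rels N X. \<forall>a\<in>X. {i. (i, a) \<in> R} \<in> F}.
        {(i, a). a \<in> X \<and> i \<in> (\<lambda>a\<in>X. {i. (i, a) \<in> R}) a} = R"
      by (auto simp: rels_def)
    show "\<forall>g\<in>X \<rightarrow>\<^sub>E F. (\<lambda>a\<in>X. {i. (i, a) \<in> {(i, a). a \<in> X \<and> i \<in> g a}}) = g"
      by (auto simp: fun_eq_iff PiE_def extensional_def)
    show "(\<lambda>R. \<lambda>a\<in>X. {i. (i, a) \<in> R}) `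
        {R \<in> rels N X. \<forall>a\<in>X. {i. (i, a) \<in> R} \<in> F} \<subseteq> X \<rightarrow>\<^sub>E F"
      by auto
    show "(\<lambda>g. {(i, a). a \<in> X \<and> i \<in> g a}) ` (X \<rightarrow>\<^sub>E F)
        \<subseteq> {R \<in> rels N X. \<forall>a\<in>X. {i. (i, a) \<in> R} \<in> F}"
    proof safe
      fix g assume g: "g \<in> X \<rightarrow>\<^sub>E F"
      show "{(i, a). a \<in> X \<and> i \<in> g a} \<in> rels N X"
        using g assms(2) unfolding rels_def by (force simp: PiE_iff)
      fix a assume "a \<in> X"
      then show "{i. (i, a) \<in> {(i, a). a \<in> X \<and> i \<in> g a}} \<in> F"
        using g by auto
    qed
  qed
  then show ?thesis
    by (simp add: bij_betw_same_card card_funcsetE[OF assms(1)])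
qed

lemma card_rels:
  assumes "finite N" "finite X"
  shows "card (rels N X) = 2 ^ (card N * card X)"
proof -
  have "{R \<in> rels N X. \<forall>a\<in>X. {i. (i, a) \<in> R} \<in> Pow N} = rels N X"
    by (auto simp: rels_def)
  then have "card (rels N X) = card (Pow N) ^ card X"
    using card_rels_fibres[OF assms(2), of "Pow N" N] by simp
  then show ?thesis
    by (simp add: card_Pow assms power_mult)
qed

lemma card_Inj_r:
  assumes "finite N" "finite X"
  shows "card (Inj_r N X) = (1 + card N) ^ card X"
proof -
  let ?F = "insert {} ((\<lambda>i. {i}) ` N)"
  have iff: "{i. (i, a) \<in> R} \<in> ?F \<longleftrightarrow> (\<forall>i\<in>N. \<forall>j\<in>N. (i, a) \<in> R \<and> (j, a) \<in> R \<longrightarrow> i = j)"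
    if "R \<in> rels N X" for R a
  proof -
    have sub: "{i. (i, a) \<in> R} \<subseteq> N" using that by (auto simp: rels_def)
    show ?thesis
    proof
      assume "{i. (i, a) \<in> R} \<in> ?F"
      then obtain k where "{i. (i, a) \<in> R} \<subseteq> {k}" by auto
      then show "\<forall>i\<in>N. \<forall>j\<in>N. (i, a) \<in> R \<and> (j, a) \<in> R \<longrightarrow> i = j" by blast
    next
      assume inj: "\<forall>i\<in>N. \<forall>j\<in>N. (i, a) \<in> R \<and> (j, a) \<in> R \<longrightarrow> i = j"
      show "{i. (i, a) \<in> R} \<in> ?F"
      proof (cases "{i. (i, a) \<in> R} = {}")
        case False
        then obtain i where "(i, a) \<in> R" by blast
        with sub inj have "{i. (i, a) \<in> R} = {i}" "i \<in> N" by blast+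
        then show ?thesis by simp
      qed simp
    qed
  qed
  have "Inj_r N X = {R \<in> rels N X. \<forall>a\<in>X. {i. (i, a) \<in> R} \<in> ?F}"
    unfolding Inj_r_def right_injective_def
    by (intro Collect_cong conj_cong refl ball_cong iff[symmetric])
  also have "card \<dots> = card ?F ^ card X"
    by (rule card_rels_fibres) (use assms in auto)
  also have "card ?F = 1 + card N"
    using assms by (subst card_insert_disjoint) (auto simp: card_image)
  finally show ?thesis .
qed

lemma card_Surj_r:
  assumes "finite N" "finite X"
  shows "int (card (Surj_r N X)) = (2 ^ card N - 1) ^ card X"
proof -
  let ?F = "Pow N - {{}}"
  have "Surj_r N X = {R \<in> rels N X. \<forall>a\<in>X. {i. (i, a) \<in> R} \<in> ?F}"
    unfolding Surj_r_def right_surjective_def rels_def by blast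
  also have "card \<dots> = card ?F ^ card X"
    by (rule card_rels_fibres) (use assms in auto)
  also have "int \<dots> = int (card ?F) ^ card X"
    by simp
  also have "int (card ?F) = 2 ^ card N - 1"
    using assms by (simp add: card_Pow of_nat_diff)
  finally show ?thesis .
qed

lemma card_Inj_l_converse: "card (Inj_l N X) = card (Inj_r X N)"
proof (rule bij_betw_same_card)
  show "bij_betw converse (Inj_l N X) (Inj_r X N)"
    by (rule bij_betw_byWitness[where f' = converse])
      (auto simp: Inj_l_def Inj_r_def rels_def left_injective_def right_injective_def)
qed

lemma card_Surj_l_converse: "card (Surj_l N X) = card (Surj_r X N)"
proof (rule bij_betw_same_card)
  show "bij_betw converse (Surj_l N X) (Surj_r X N)"
    by (rule bij_betw_byWitness[where f' = converse])
      (auto simp: Surj_l_def Surj_r_def rels_def left_surjective_def right_surjective_def)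
qed

section \<open>Sorting relations by their domain\<close>

lemma card_rels_by_Domain:
  assumes "finite N" "finite X" "C \<subseteq> rels N X"
  shows "card C = (\<Sum>A\<in>Pow N. card {R \<in> C. Domain R = A})"
proof -
  have "finite C"
    using assms finite_subset[of C "Pow (N \<times> X)"] by (auto simp: rels_def)
  moreover have "Domain ` C \<subseteq> Pow N"
    using assms(3) by (auto simp: rels_def)
  ultimately have "(\<Sum>A\<in>Pow N. \<Sum>R | R \<in> C \<and> Domain R = A. 1) = (\<Sum>R\<in>C. 1::nat)"
    using assms(1) by (intro sum.group) auto
  then show ?thesis by simp
qed

lemma sum_Pow_by_card:
  fixes h :: "nat \<Rightarrow> 'c::comm_semiring_1"
  assumes "finite N"
  shows "(\<Sum>A\<in>Pow N. h (card A)) = (\<Sum>k=0..card N. of_nat (card N choose k) * h k)"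
proof -
  have "(\<Sum>A\<in>Pow N. h (card A)) = (\<Sum>k=0..card N. \<Sum>A | A \<in> Pow N \<and> card A = k. h (card A))"
    using assms by (intro sum.group[symmetric]) (auto simp: card_mono)
  also have "\<dots> = (\<Sum>k=0..card N. of_nat (card N choose k) * h k)"
    using n_subsets[OF assms] by (intro sum.cong) auto
  finally show ?thesis .
qed

section \<open>Partial matchings\<close>

text \<open>Once the domain is fixed to be \<open>A\<close>, left injectivity makes the relation the graph of a function
  from \<open>A\<close> to \<open>X\<close>, and right injectivity makes that function injective; the product counts the
  choices of its values one after the other.\<close>

lemma card_Inj_lr_Domain:
  assumes "finite N" "finite X" "A \<subseteq> N"
  shows "card {R \<in> Inj_lr N X. Domain R = A} = (\<Prod>i<card A. card X - i)"
proof -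
  let ?graph = "\<lambda>f. {(i, f i) |i. i \<in> A}"
  have "bij_betw ?graph {f \<in> A \<rightarrow>\<^sub>E X. inj_on f A} {R \<in> Inj_lr N X. Domain R = A}"
    unfolding bij_betw_def
  proof
    show "inj_on ?graph {f \<in> A \<rightarrow>\<^sub>E X. inj_on f A}"
    proof (rule inj_onI)
      fix f g assume fg: "f \<in> {f \<in> A \<rightarrow>\<^sub>E X. inj_on f A}" "g \<in> {f \<in> A \<rightarrow>\<^sub>E X. inj_on f A}"
        and eq: "?graph f = ?graph g"
      have "f i = g i" if "i \<in> A" for i
      proof -
        have "(i, f i) \<in> ?graph f" using that by blast
        then have "(i, f i) \<in> ?graph g" unfolding eq .
        then show ?thesis by blast
      qed
      with fg show "f = g" by (auto intro: PiE_ext)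
    qed
    show "?graph ` {f \<in> A \<rightarrow>\<^sub>E X. inj_on f A} = {R \<in> Inj_lr N X. Domain R = A}"
    proof (intro equalityI subsetI)
      fix R assume "R \<in> ?graph ` {f \<in> A \<rightarrow>\<^sub>E X. inj_on f A}"
      then obtain f where f: "f \<in> A \<rightarrow>\<^sub>E X" "inj_on f A" "R = ?graph f" by auto
      then show "R \<in> {R \<in> Inj_lr N X. Domain R = A}"
        using assms(3) unfolding Inj_lr_def rels_def left_injective_def right_injective_def
        by (auto simp: inj_on_def)
    next
      fix R assume R: "R \<in> {R \<in> Inj_lr N X. Domain R = A}"
      then have sub: "R \<subseteq> N \<times> X" and dom: "Domain R = A"
        and l: "\<And>i a b. (i, a) \<in> R \<Longrightarrow> (i, b) \<in> R \<Longrightarrow> a = b"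
        and r: "\<And>i j a. (i, a) \<in> R \<Longrightarrow> (j, a) \<in> R \<Longrightarrow> i = j"
        unfolding Inj_lr_def rels_def left_injective_def right_injective_def by blast+
      define f where "f = (\<lambda>i\<in>A. THE a. (i, a) \<in> R)"
      have f: "(i, a) \<in> R \<longleftrightarrow> i \<in> A \<and> a = f i" for i a
      proof -
        have "f i = b" if "(i, b) \<in> R" for b
        proof -
          have "(THE a. (i, a) \<in> R) = b"
            using that l by (intro the_equality)
          moreover have "i \<in> A" using that dom by blast
          ultimately show ?thesis by (simp add: f_def)
        qed
        then show ?thesis using dom by blast
      qed
      have "f i \<in> X" if "i \<in> A" for i
        using f[of i "f i"] that sub by blast
      moreover have "f \<in> extensional A"
        by (simp add: f_def)
      ultimately have "f \<in> A \<rightarrow>\<^sub>E X"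
        by (auto simp: PiE_def)
      moreover have "inj_on f A"
        using f r by (intro inj_onI) metis
      moreover have "R = ?graph f"
        using f by auto
      ultimately show "R \<in> ?graph ` {f \<in> A \<rightarrow>\<^sub>E X. inj_on f A}" by blast
    qed
  qed
  then have "card {R \<in> Inj_lr N X. Domain R = A} = card {f \<in> A \<rightarrow>\<^sub>E X. inj_on f A}"
    by (simp add: bij_betw_same_card)
  also have "\<dots> = (\<Prod>i<card A. card X - i)"
    using card_inj_on_subset_funcset[of A X A] assms finite_subset[OF assms(3,1)]
    by (simp add: lessThan_atLeast0)
  finally show ?thesis .
qed

lemma prod_diff_eq_choose_fact: "(\<Prod>i<k. x - i) = (x choose k) * fact k" for x k :: nat
proof (induction k)
  case (Suc k)
  have step: "(x choose Suc k) * Suc k = (x choose k) * (x - k)"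
    using binomial_absorption[of k x] binomial_absorb_comp[of x k] by (simp add: mult.commute)
  have "(\<Prod>i<Suc k. x - i) = (x choose k) * (x - k) * fact k"
    using Suc by simp
  also have "\<dots> = (x choose Suc k) * fact (Suc k)"
    unfolding step[symmetric] by (simp add: algebra_simps)
  finally show ?case .
qed simp

text \<open>For \<open>k > x\<close> both sides vanish: each product contains the factor for \<open>i = x\<close>, so that the truncated
  differences beyond it do no harm.\<close>

lemma int_prod_diff_eq_falling_fact: "int (\<Prod>i<k. x - i) = falling_fact (int x) k"
proof (cases "k \<le> x")
  case True
  then show ?thesis
    unfolding falling_fact_def of_nat_prod by (intro prod.cong) (auto simp: of_nat_diff)
next
  case False
  then have "(\<Prod>i<k. x - i) = 0" "falling_fact (int x) k = 0"
    unfolding falling_fact_def by (auto intro!: prod_zero bexI[of _ x])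
  then show ?thesis by simp
qed

lemma card_Inj_lr:
  assumes "finite N" "finite X"
  shows "card (Inj_lr N X) =
    (\<Sum>k=0..min (card N) (card X). (card N choose k) * (\<Prod>i<k. card X - i))"
proof -
  have "card (Inj_lr N X) = (\<Sum>A\<in>Pow N. card {R \<in> Inj_lr N X. Domain R = A})"
    using assms by (intro card_rels_by_Domain) (auto simp: Inj_lr_def)
  also have "\<dots> = (\<Sum>A\<in>Pow N. \<Prod>i<card A. card X - i)"
    using card_Inj_lr_Domain[OF assms] by simp
  also have "\<dots> = (\<Sum>k=0..card N. (card N choose k) * (\<Prod>i<k. card X - i))"
    using sum_Pow_by_card[OF assms(1), of "\<lambda>k. \<Prod>i<k. card X - i"] by simp
  also have "\<dots> = (\<Sum>k=0..min (card N) (card X). (card N choose k) * (\<Prod>i<k. card X - i))"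
    by (rule sum.mono_neutral_right) (auto simp: prod_diff_eq_choose_fact)
  finally show ?thesis .
qed

section \<open>Relations surjective on both sides\<close>

text \<open>Right surjectivity does not mention the points of \<open>S\<close> outside the domain, and every relation is left
  surjective on its own domain.\<close>

lemma int_card_Surj_r_eq_sum_Surj_lr:
  assumes "finite S" "finite X"
  shows "int (card (Surj_r S X)) = (\<Sum>T\<in>Pow S. int (card (Surj_lr T X)))"
proof -
  have "{R \<in> Surj_r S X. Domain R = T} = Surj_lr T X" if "T \<subseteq> S" for T
    using that
    unfolding Surj_r_def Surj_lr_def rels_def right_surjective_def left_surjective_def
    by fastforce
  moreover have "card (Surj_r S X) = (\<Sum>T\<in>Pow S. card {R \<in> Surj_r S X. Domain R = T})"
    using assms by (intro card_rels_by_Domain) (auto simp: Surj_r_def)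
  ultimately show ?thesis by simp
qed

lemma card_Surj_lr:
  assumes "finite N" "finite X"
  shows "int (card (Surj_lr N X)) =
    (\<Sum>k=0..card N. (-1) ^ k * int (card N choose k) * (2 ^ (card N - k) - 1) ^ card X)"
proof -
  let ?n = "card N" and ?x = "card X"
  have "int (card (Surj_lr N X)) =
      (\<Sum>T\<in>Pow N. (-1) ^ (?n - card T) * (2 ^ card T - 1) ^ ?x)"
  proof (rule inclusion_exclusion_mobius[where g = "\<lambda>S. (2 ^ card S - 1) ^ ?x"])
    show "(2 ^ card S - 1) ^ ?x = (\<Sum>T\<in>Pow S. int (card (Surj_lr T X)))"
      if "finite S" for S :: "'a set"
      using that assms(2) by (simp flip: card_Surj_r int_card_Surj_r_eq_sum_Surj_lr)
  qed (fact assms(1))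
  also have "\<dots> = (\<Sum>k=0..?n. int (?n choose k) * ((-1) ^ (?n - k) * (2 ^ k - 1) ^ ?x))"
    using sum_Pow_by_card[OF assms(1), of "\<lambda>k. (-1) ^ (?n - k) * (2 ^ k - 1) ^ ?x :: int"]
    by simp
  (* the summation index now becomes the size of the complement of T *)
  also have "\<dots> = (\<Sum>k=0..?n. (-1) ^ k * int (?n choose k) * (2 ^ (?n - k) - 1) ^ ?x)"
    by (rule sum.reindex_bij_witness[of _ "\<lambda>k. ?n - k" "\<lambda>k. ?n - k"])
      (auto simp: binomial_symmetric[symmetric])
  finally show ?thesis .
qed

section \<open>The enumeration\<close>

theorem theorem8p1:
  fixes N :: "'a set" and X :: "'b set" and n x :: nat
  assumes "finite N" and "finite X"
    and "n = card N" and "x = card X"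
  shows "card (rels N X) = 2 ^ (n * x) \<and>
    card (Inj_r N X) = (1 + n) ^ x \<and>
    int (card (Surj_r N X)) = (2 ^ n - 1) ^ x \<and>
    card (Inj_lr N X) = (\<Sum>k=0..min n x. (n choose k) * (x choose k) * fact k) \<and>
    int (card (Inj_lr N X)) = (\<Sum>k=0..min n x. int (n choose k) * falling_fact (int x) k) \<and>
    int (card (Surj_lr N X)) =
      (\<Sum>k=0..n. (-1) ^ k * int (n choose k) * (2 ^ (n - k) - 1) ^ x) \<and>
    card (Inj_l N X) = (1 + x) ^ n \<and>
    int (card (Surj_l N X)) = (2 ^ x - 1) ^ n"
proof (intro conjI)
  have fin: "finite N" "finite X" by fact+
  have Inj_lr: "card (Inj_lr N X) = (\<Sum>k=0..min n x. (n choose k) * (\<Prod>i<k. x - i))"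
    using card_Inj_lr[OF fin] assms(3,4) by simp
  show "card (rels N X) = 2 ^ (n * x)"
    using card_rels[OF fin] assms(3,4) by simp
  show "card (Inj_r N X) = (1 + n) ^ x"
    using card_Inj_r[OF fin] assms(3,4) by simp
  show "int (card (Surj_r N X)) = (2 ^ n - 1) ^ x"
    using card_Surj_r[OF fin] assms(3,4) by simp
  show "card (Inj_lr N X) = (\<Sum>k=0..min n x. (n choose k) * (x choose k) * fact k)"
    unfolding Inj_lr prod_diff_eq_choose_fact by (simp add: mult.assoc)
  show "int (card (Inj_lr N X)) = (\<Sum>k=0..min n x. int (n choose k) * falling_fact (int x) k)"
    unfolding Inj_lr by (simp flip: int_prod_diff_eq_falling_fact)
  show "int (card (Surj_lr N X)) =
      (\<Sum>k=0..n. (-1) ^ k * int (n choose k) * (2 ^ (n - k) - 1) ^ x)"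
    using card_Surj_lr[OF fin] assms(3,4) by simp
  show "card (Inj_l N X) = (1 + x) ^ n"
    using card_Inj_r[OF fin(2,1)] assms(3,4) by (simp add: card_Inj_l_converse)
  show "int (card (Surj_l N X)) = (2 ^ x - 1) ^ n"
    using card_Surj_r[OF fin(2,1)] assms(3,4) by (simp add: card_Surj_l_converse)
qed

end
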